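(* Let $\mathcal{A}$ be a configuration of type $(m,1^n)$ in $\mathbb{C}^2$, with vectors normalized as $\alpha_s=(\cos\varphi_s,\sin\varphi_s)$ and $z_s=e^{2i\varphi_s}$, $0\le s\le n$. Suppose that for all $j=0,\dots,n$ $$\sum_{i=0,\ i\ne j}^n \frac{m_i(z_i+z_j)}{z_i-z_j}=0 .$$ Let $e_k$ be the $k$-th elementary symmetric polynomial in the variables $z_1,\dots,z_n$. Then for any $k=1,\dots,n$ $$e_k=\frac{(-1)^k\prod_{j=1}^k(m+j-1)(n-j+1)\,z_0^k}{k!\prod_{j=1}^k(m+n-j)}=\frac{(-1)^k\binom{n}{k}\binom{m+k-1}{k}z_0^k}{\binom{m+n-1}{k}} .$$
   Context: A configuration of type $(m,1^n)$ ($m,n\ge1$ integers) consists of $n+1$ pairwise non-collinear vectors $\alpha_0,\dots,\alpha_n\in\mathbb{C}^2$ with multiplicities $m_0=m$, $m_i=1$ for $1\le i\le n$. All vectors are assumed non-isotropic, $(\alpha_i,\alpha_i)\ne 0$ for the standard complex bilinear form $(u,v)=u_1v_1+u_2v_2$, and are normalized so that $(\alpha_s,\alpha_s)=1$; then $\alpha_s=(\cos\varphi_s,\sin\varphi_s)$ for some $\varphi_s\in\mathbb{C}$. *)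

theory Defs
  imports "HOL-Analysis.Analysis"
begin

text \<open>The standard form on \<open>\<complex>\<^sup>2\<close> is complex bilinear, not Hermitian; the library's inner product
  on \<^typ>\<open>complex^2\<close> is real-valued and does not apply.\<close>

definition bilin :: "complex^2 \<Rightarrow> complex^2 \<Rightarrow> complex" where
  "bilin u v = u $ 1 * v $ 1 + u $ 2 * v $ 2"

text \<open>Collinearity is over \<open>\<complex>\<close>; the library's \<^const>\<open>collinear\<close> uses real scalars.\<close>

definition ccollinear :: "complex^2 \<Rightarrow> complex^2 \<Rightarrow> bool" where
  "ccollinear u v \<longleftrightarrow> (\<exists>c. u = c *s v \<or> v = c *s u)"

text \<open>Configurations of type \<open>(m, 1\<^sup>n)\<close>: vectors \<open>\<alpha> 0, \<dots>, \<alpha> n\<close> with multiplicities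
  \<open>\<mu> 0, \<dots>, \<mu> n\<close>. Values of \<open>\<alpha>\<close> and \<open>\<mu>\<close> at indices above \<open>n\<close> are irrelevant.\<close>

definition configuration :: "nat \<Rightarrow> nat \<Rightarrow> (nat \<Rightarrow> complex^2) \<Rightarrow> (nat \<Rightarrow> nat) \<Rightarrow> bool" where
  "configuration m n \<alpha> \<mu> \<longleftrightarrow>
     m \<ge> 1 \<and> n \<ge> 1 \<and>
     (\<forall>i\<le>n. \<forall>j\<le>n. i \<noteq> j \<longrightarrow> \<not> ccollinear (\<alpha> i) (\<alpha> j)) \<and>
     (\<forall>i\<le>n. bilin (\<alpha> i) (\<alpha> i) \<noteq> 0) \<and>
     \<mu> 0 = m \<and> (\<forall>i\<in>{1..n}. \<mu> i = 1)"

definition elem_sym :: "'i set \<Rightarrow> nat \<Rightarrow> ('i \<Rightarrow> 'a::comm_semiring_1) \<Rightarrow> 'a" where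
  "elem_sym I k x = (\<Sum>S | S \<subseteq> I \<and> card S = k. \<Prod>i\<in>S. x i)"

end

theory Submission
  imports Defs "HOL-Computational_Algebra.Polynomial"
begin

text \<open>
  Put \<open>w = z\<^sub>0\<close> and \<open>p(x) = (x - z\<^sub>1)\<cdots>(x - z\<^sub>n)\<close>. Since \<open>p''(z\<^sub>j) / p'(z\<^sub>j) = 2 \<Sum> 1 / (z\<^sub>j - z\<^sub>i)\<close>, the
  equations for \<open>j \<ge> 1\<close> say that the polynomial
  \<open>(w - x) ((n - 1) p' - x p'') + m (w + x) p' - m n p\<close>
  vanishes at the \<open>n\<close> roots of \<open>p\<close>. Its coefficient of \<open>x\<^sup>n\<close> is zero, so it is identically zero.
  This hypergeometric differential equation for \<open>p\<close> amounts to a two-term recurrence for the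
  coefficients of \<open>p\<close>, which are the \<open>e\<^sub>k\<close> up to sign.
\<close>

text \<open>Vieta: expand the product by the set \<open>X\<close> of factors that contribute
  \<open>- z i\<close>. Such a choice gives a monomial of degree
  \<open>card I - card X\<close>.\<close>

lemma coeff_prod_linear:
  fixes z :: "'i \<Rightarrow> 'a::comm_ring_1"
  assumes "finite I" "k \<le> card I"
  shows "coeff (\<Prod>i\<in>I. [:- z i, 1:]) (card I - k) = (- 1) ^ k * elem_sym I k z"
proof -
  have const_prod: "(\<Prod>i\<in>X. [:z i:]) = [:\<Prod>i\<in>X. z i:]" for X
    by (induction X rule: infinite_finite_induct) (auto simp: one_pCons)
  have const_power: "(- 1) ^ l = [:(- 1 :: 'a) ^ l:]" for l :: nat
    by (induction l) (auto simp: one_pCons)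
  have "(\<Prod>i\<in>I. [:- z i, 1:]) = (\<Prod>i\<in>I. [:0, 1:] - [:z i:])"
    by simp
  also have "\<dots> = (\<Sum>X\<in>Pow I. (- 1) ^ card X * (\<Prod>i\<in>X. [:z i:]) * (\<Prod>i\<in>I - X. [:0, 1:]))"
    by (rule prod_diff_conv_sum[OF assms(1)])
  also have "\<dots> = (\<Sum>X\<in>Pow I. monom ((- 1) ^ card X * (\<Prod>i\<in>X. z i)) (card I - card X))"
    using assms(1)
    by (intro sum.cong refl)
      (auto simp: const_prod const_power card_Diff_subset finite_subset monom_altdef mult.commute)
  also have "coeff \<dots> (card I - k) =
      (\<Sum>X\<in>Pow I. if card X = k then (- 1) ^ card X * (\<Prod>i\<in>X. z i) else 0)"
    unfolding coeff_sum
  proof (intro sum.cong refl)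
    fix X assume "X \<in> Pow I"
    with assms(1) have "card X \<le> card I"
      by (auto intro: card_mono)
    \<comment> \<open>Since \<open>card X\<close> and \<open>k\<close> are both at most
      \<open>card I\<close>, the subtractions are not truncated, and equal exponents force
      \<open>card X = k\<close>.\<close>
    with assms(2) show
      "coeff (monom ((- 1) ^ card X * (\<Prod>i\<in>X. z i)) (card I - card X)) (card I - k) =
        (if card X = k then (- 1) ^ card X * (\<Prod>i\<in>X. z i) else 0)"
      by auto
  qed
  also have "\<dots> = (\<Sum>X | X \<in> Pow I \<and> card X = k. (- 1) ^ k * (\<Prod>i\<in>X. z i))"
    using assms(1) by (subst sum.inter_filter) (auto intro!: sum.cong)
  finally show ?thesis
    by (simp add: elem_sym_def sum_distrib_left)
qed

text \<open>Split off the factor vanishing at \<open>z j\<close>, so that p = (x - z j) g. Then p'(z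
  j) = g(z j) and p''(z j) = 2 g'(z j), and the sum is the logarithmic derivative g'/g at
  \<open>z j\<close>.\<close>

lemma poly_pderiv2_prod_linear:
  fixes z :: "'i \<Rightarrow> 'a::field"
  assumes "finite I" "inj_on z I" "j \<in> I"
  shows "poly (pderiv (pderiv (\<Prod>i\<in>I. [:- z i, 1:]))) (z j) =
    2 * poly (pderiv (\<Prod>i\<in>I. [:- z i, 1:])) (z j) * (\<Sum>i\<in>I - {j}. 1 / (z j - z i))"
proof -
  define g where "g = (\<Prod>i\<in>I - {j}. [:- z i, 1:])"
  have ne: "z j - z i \<noteq> 0" if "i \<in> I - {j}" for i
    using assms that by (auto dest: inj_onD)
  have p: "(\<Prod>i\<in>I. [:- z i, 1:]) = [:- z j, 1:] * g"
    unfolding g_def using assms by (simp add: prod.remove)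
  have d1: "poly (pderiv ([:- z j, 1:] * g)) (z j) = poly g (z j)"
    by (simp only: pderiv_mult) (simp add: pderiv_pCons)
  have "pderiv (pderiv ([:- z j, 1:] * g)) = [:- z j, 1:] * pderiv (pderiv g) + 2 * pderiv g"
    by (simp only: pderiv_mult pderiv_add) (simp add: pderiv_pCons pderiv_mult)
  then have d2: "poly (pderiv (pderiv ([:- z j, 1:] * g))) (z j) = 2 * poly (pderiv g) (z j)"
    by simp
  have gz: "poly g (z j) = (\<Prod>i\<in>I - {j}. z j - z i)"
    by (simp add: g_def poly_prod)
  have "poly (pderiv g) (z j) = (\<Sum>i\<in>I - {j}. \<Prod>l\<in>I - {j} - {i}. z j - z l)"
    by (simp add: g_def pderiv_prod poly_sum poly_prod pderiv_pCons)
  also have "\<dots> = (\<Sum>i\<in>I - {j}. poly g (z j) * (1 / (z j - z i)))"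
  proof (intro sum.cong refl)
    fix i assume i: "i \<in> I - {j}"
    then have "poly g (z j) = (z j - z i) * (\<Prod>l\<in>I - {j} - {i}. z j - z l)"
      unfolding gz using assms(1) by (intro prod.remove) auto
    with ne[OF i] show "(\<Prod>l\<in>I - {j} - {i}. z j - z l) = poly g (z j) * (1 / (z j - z i))"
      by simp
  qed
  finally have dg: "poly (pderiv g) (z j) = poly g (z j) * (\<Sum>i\<in>I - {j}. 1 / (z j - z i))"
    by (simp add: sum_distrib_left)
  show ?thesis
    unfolding p d1 d2 dg by simp
qed

lemma elem_sym_0 [simp]: "finite I \<Longrightarrow> elem_sym I 0 x = 1"
proof -
  assume "finite I"
  \<comment> \<open>Finiteness matters here: an infinite subset would also have \<open>card\<close>
    0.\<close>
  then have "{S. S \<subseteq> I \<and> card S = 0} = {{}}"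
    by (auto dest: finite_subset)
  then show ?thesis
    by (simp add: elem_sym_def)
qed

lemma elem_sym_recurrence:
  fixes z :: "'i \<Rightarrow> 'a::field" and w :: 'a and m :: nat
  assumes I: "finite I" "inj_on z I"
    and w: "w \<notin> z ` I"
    and locus: "\<And>j. j \<in> I \<Longrightarrow>
      of_nat m * (w + z j) / (w - z j) + (\<Sum>i\<in>I - {j}. (z i + z j) / (z i - z j)) = 0"
    and k: "Suc k \<le> card I"
  shows "of_nat (Suc k) * of_nat (m + card I - Suc k) * elem_sym I (Suc k) z =
    - (w * of_nat (m + k) * of_nat (card I - k) * elem_sym I k z)"
proof -
  define n where "n = card I"
  define N M :: 'a where "N = of_nat n" and "M = of_nat m"
  define p where "p = (\<Prod>i\<in>I. [:- z i, 1:])"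
  \<comment> \<open>The left-hand side of the differential equation, multiplied out;
    \<open>pCons 0\<close> is multiplication by x.\<close>
  define q where "q = smult (w * (N - 1 + M)) (pderiv p) - smult w (pCons 0 (pderiv (pderiv p)))
    - smult (N - 1 - M) (pCons 0 (pderiv p)) + pCons 0 (pCons 0 (pderiv (pderiv p)))
    - smult (M * N) p"
  \<comment> \<open>Every term of \<open>q\<close> either keeps the degree or lowers it by one, so
    only two coefficients of \<open>p\<close> enter. The case split isolates degrees 0 and 1, where
    the shifts by x and x^2 bring in zeros.\<close>
  have coeff_q: "coeff q l = w * (of_nat l + 1) * (N - 1 - of_nat l + M) * coeff p (Suc l)
      - (N - of_nat l) * (M + of_nat l) * coeff p l" for l
    by (cases l; cases "l - 1") (simp_all add: q_def coeff_pderiv algebra_simps)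
  have "degree p = n"
    unfolding p_def n_def by (subst degree_prod_sum_eq) auto
  have root: "poly q (z j) = 0" if j: "j \<in> I" for j
  proof -
    define P where "P = poly (pderiv p) (z j)"
    define S where "S = (\<Sum>i\<in>I - {j}. 1 / (z j - z i))"
    have ne: "w - z j \<noteq> 0"
      using w j by auto
    \<comment> \<open>Rewriting each summand this way exposes \<open>S\<close>, through which p''
      enters at a root.\<close>
    have "(\<Sum>i\<in>I - {j}. (z i + z j) / (z i - z j)) = (\<Sum>i\<in>I - {j}. 1 - 2 * z j * (1 / (z j - z i)))"
    proof (intro sum.cong refl)
      fix i assume "i \<in> I - {j}"
      then have "z i \<noteq> z j"
        using I j by (auto dest: inj_onD)
      then show "(z i + z j) / (z i - z j) = 1 - 2 * z j * (1 / (z j - z i))"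
        by (simp add: field_simps)
    qed
    also have "\<dots> = N - 1 - 2 * z j * S"
    proof -
      have "n > 0"
        using I j by (auto simp: n_def card_gt_0_iff)
      then show ?thesis
        using I j by (simp add: sum_subtractf sum_distrib_left S_def N_def n_def of_nat_diff)
    qed
    finally have "M * (w + z j) / (w - z j) + (N - 1 - 2 * z j * S) = 0"
      using locus[OF j] by (simp add: M_def)
    then have eq: "M * (w + z j) + (w - z j) * (N - 1 - 2 * z j * S) = 0"
      using ne by (simp add: field_simps)
    have p0: "poly p (z j) = 0"
      using I j by (auto simp: p_def poly_prod)
    have p2: "poly (pderiv (pderiv p)) (z j) = 2 * P * S"
      using poly_pderiv2_prod_linear[OF I j] by (simp add: p_def P_def S_def)
    have "poly q (z j) = P * (M * (w + z j) + (w - z j) * (N - 1 - 2 * z j * S))"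
      unfolding q_def by (simp add: p0 p2 flip: P_def) (simp add: algebra_simps)
    with eq show ?thesis
      by simp
  qed
  have "q = 0"
  proof (rule poly_eqI_degree)
    have "coeff q l = 0" if "l \<ge> n" for l
      using that \<open>degree p = n\<close> by (cases "l = n") (simp_all add: coeff_q coeff_eq_0 N_def)
    then have "degree q < n"
      using k by (intro degree_lessI) (auto simp: n_def)
    then show "card (z ` I) > degree q"
      using I by (simp add: card_image n_def)
    then show "card (z ` I) > degree 0"
      by simp
  qed (use root in auto)
  \<comment> \<open>This degree pairs the coefficients of \<open>p\<close> that are, up to sign, the
    elementary symmetric polynomials of orders \<open>k\<close> and \<open>Suc k\<close>.\<close>
  then have "coeff q (n - Suc k) = 0"
    by simp
  moreover have "Suc (n - Suc k) = n - k"
    using k by (simp add: n_def)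
  moreover have "coeff p (n - k) = (- 1) ^ k * elem_sym I k z"
      "coeff p (n - Suc k) = (- 1) ^ Suc k * elem_sym I (Suc k) z"
    unfolding p_def n_def using I k by (intro coeff_prod_linear; simp)+
  ultimately have "(- 1) ^ k * (w * (of_nat (n - Suc k) + 1) * (N - 1 - of_nat (n - Suc k) + M)
        * elem_sym I k z + (N - of_nat (n - Suc k)) * (M + of_nat (n - Suc k)) * elem_sym I (Suc k) z) = 0"
    unfolding coeff_q by (simp add: algebra_simps)
  then have "w * (of_nat (n - Suc k) + 1) * (N - 1 - of_nat (n - Suc k) + M)
        * elem_sym I k z + (N - of_nat (n - Suc k)) * (M + of_nat (n - Suc k)) * elem_sym I (Suc k) z = 0"
    by simp
  with k show ?thesis
    by (simp add: N_def M_def of_nat_diff algebra_simps flip: n_def)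
qed

text \<open>The product is the falling factorial a (a - 1) ... (a - k + 1). For k > a it contains
  the zero factor j = a + 1, matching the zero binomial.\<close>

lemma prod_of_nat_diff_eq_fact_binomial:
  "(\<Prod>j=1..k. of_nat (Suc a) - of_nat j) = fact k * (of_nat (a choose k) :: 'a::field_char_0)"
proof -
  have "(\<Prod>j=1..k. of_nat (Suc a) - of_nat j) = (\<Prod>i=0..<k. of_nat a - of_nat i :: 'a)"
    by (rule prod.reindex_bij_witness[of _ Suc "\<lambda>j. j - 1"]) (auto simp: of_nat_diff)
  then show ?thesis
    by (simp add: binomial_gbinomial gbinomial_prod_rev)
qed

text \<open>The rising factorial m (m + 1) ... (m + k - 1); the induction step is the absorption
  identity for binomials.\<close>

lemma prod_of_nat_add_eq_fact_binomial:
  assumes "m \<ge> 1"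
  shows "(\<Prod>j=1..k. of_nat m + of_nat j - 1) =
    fact k * (of_nat ((m + k - 1) choose k) :: 'a::field_char_0)"
proof (induction k)
  case (Suc k)
  have "Suc k * ((m + k) choose Suc k) = (m + k) * ((m + k - 1) choose k)"
    by (rule binomial_absorption)
  then have "of_nat (Suc k) * of_nat ((m + k) choose Suc k) =
      (of_nat (m + k) * of_nat ((m + k - 1) choose k) :: 'a)"
    by (metis of_nat_mult)
  then have "fact (Suc k) * of_nat ((m + k) choose Suc k) =
      fact k * (of_nat ((m + k - 1) choose k) :: 'a) * of_nat (m + k)"
    by (simp only: fact_Suc mult_ac)
  with Suc show ?case
    by simp
qed simp

text \<open>The doubled angles agree modulo 2 pi, so the angles agree modulo pi and the vectors
  agree up to the sign cos(l pi). Hence non-collinear vectors have distinct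
  \<open>z\<close>.\<close>

lemma exp_double_eq_imp_ccollinear:
  assumes "exp (2 * \<i> * x) = exp (2 * \<i> * y)"
  shows "ccollinear (vector [cos x, sin x]) (vector [cos y, sin y])"
proof -
  obtain l :: int where "2 * \<i> * x = 2 * \<i> * y + of_int (2 * l) * pi * \<i>"
    using assms by (auto simp: exp_eq)
  then have "2 * \<i> * x = 2 * \<i> * (y + of_int l * pi)"
    by (simp add: algebra_simps)
  then have x: "x = y + of_int l * pi"
    by simp
  have "sin (of_int l * pi :: complex) = 0"
    by (simp add: sin_eq_0)
  then have "vector [cos x, sin x] = cos (of_int l * of_real pi) *s (vector [cos y, sin y] :: complex^2)"
    by (simp add: x cos_add sin_add vec_eq_iff forall_2)
  then show ?thesis
    unfolding ccollinear_def by blast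
qed

theorem theorem2p5:
  fixes m n :: nat
    and \<alpha> :: "nat \<Rightarrow> complex^2"
    and \<mu> :: "nat \<Rightarrow> nat"
    and \<phi> z :: "nat \<Rightarrow> complex"
  assumes config: "configuration m n \<alpha> \<mu>"
    and normalized: "\<forall>s\<le>n. \<alpha> s = vector [cos (\<phi> s), sin (\<phi> s)]"
    and z: "\<forall>s\<le>n. z s = exp (2 * \<i> * \<phi> s)"
    and locus: "\<forall>j\<le>n. (\<Sum>i\<in>{0..n} - {j}. of_nat (\<mu> i) * (z i + z j) / (z i - z j)) = 0"
  shows "\<forall>k\<in>{1..n}.
    elem_sym {1..n} k z =
      (- 1) ^ k * (\<Prod>j=1..k. (of_nat m + of_nat j - 1) * (of_nat n - of_nat j + 1)) * z 0 ^ k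
        / (fact k * (\<Prod>j=1..k. of_nat m + of_nat n - of_nat j)) \<and>
    elem_sym {1..n} k z =
      (- 1) ^ k * of_nat (n choose k) * of_nat ((m + k - 1) choose k) * z 0 ^ k
        / of_nat ((m + n - 1) choose k)"
proof -
  have m: "m \<ge> 1" and \<mu>0: "\<mu> 0 = m" and \<mu>1: "\<And>i. i \<in> {1..n} \<Longrightarrow> \<mu> i = 1"
    using config by (auto simp: configuration_def)
  have "inj_on z {0..n}"
    using config normalized z exp_double_eq_imp_ccollinear
    by (fastforce simp: configuration_def inj_on_def)
  then have inj: "inj_on z {1..n}" and z0: "z 0 \<notin> z ` {1..n}"
    by (fastforce simp: inj_on_def)+
  have locus': "of_nat m * (z 0 + z j) / (z 0 - z j)
      + (\<Sum>i\<in>{1..n} - {j}. (z i + z j) / (z i - z j)) = 0" if j: "j \<in> {1..n}" for j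
  proof -
    have "{0..n} - {j} = insert 0 ({1..n} - {j})"
      using j by auto
    then have "(\<Sum>i\<in>{0..n} - {j}. of_nat (\<mu> i) * (z i + z j) / (z i - z j)) =
      of_nat m * (z 0 + z j) / (z 0 - z j)
      + (\<Sum>i\<in>{1..n} - {j}. of_nat (\<mu> i) * (z i + z j) / (z i - z j))"
      by (simp add: \<mu>0)
    then show ?thesis
      using locus j \<mu>1 by simp
  qed
  have rec: "elem_sym {1..n} (Suc k) z = - (z 0 * of_nat (m + k) * of_nat (n - k) *
      elem_sym {1..n} k z) / (of_nat (Suc k) * of_nat (m + n - Suc k))" if "Suc k \<le> n" for k
  proof -
    \<comment> \<open>Here m + n - (k + 1) >= m >= 1, so the recurrence can be solved for the next
      elementary symmetric polynomial.\<close>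
    have ne: "of_nat (Suc k) * of_nat (m + n - Suc k) \<noteq> (0 :: complex)"
      using m that by (simp only: mult_eq_0_iff of_nat_eq_0_iff) simp
    have "of_nat (Suc k) * of_nat (m + n - Suc k) * elem_sym {1..n} (Suc k) z =
        - (z 0 * of_nat (m + k) * of_nat (n - k) * elem_sym {1..n} k z)"
      using elem_sym_recurrence[OF _ inj z0 locus', of k] that by simp
    then show ?thesis
      by (simp only: nonzero_eq_divide_eq[OF ne] mult_ac)
  qed
  have prod_form: "elem_sym {1..n} k z =
      (- 1) ^ k * (\<Prod>j=1..k. (of_nat m + of_nat j - 1) * (of_nat n - of_nat j + 1)) * z 0 ^ k
        / (fact k * (\<Prod>j=1..k. of_nat m + of_nat n - of_nat j))" if "k \<le> n" for k
    using that
  proof (induction k)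
    case (Suc k)
    define A B :: complex
      where "A = (\<Prod>j=1..k. (of_nat m + of_nat j - 1) * (of_nat n - of_nat j + 1))"
        and "B = (\<Prod>j=1..k. of_nat m + of_nat n - of_nat j)"
    \<comment> \<open>The factors contributed by j = k + 1: m + j - 1, n - j + 1 and m + n -
      j.\<close>
    define a b d :: complex
      where "a = of_nat (m + k)" and "b = of_nat (n - k)" and "d = of_nat (m + n - Suc k)"
    have "(\<Prod>j=1..Suc k. (of_nat m + of_nat j - 1) * (of_nat n - of_nat j + 1)) = A * (a * b)"
      and "(\<Prod>j=1..Suc k. of_nat m + of_nat n - of_nat j) = B * d"
      using Suc.prems by (simp_all add: A_def B_def a_def b_def d_def of_nat_diff)
    moreover have "elem_sym {1..n} k z = (- 1) ^ k * A * z 0 ^ k / (fact k * B)"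
      using Suc by (simp add: A_def B_def)
    moreover have "elem_sym {1..n} (Suc k) z =
        - (z 0 * a * b * elem_sym {1..n} k z) / (of_nat (Suc k) * d)"
      unfolding a_def b_def d_def using Suc.prems by (rule rec)
    ultimately show ?case
      by (simp only: fact_Suc of_nat_mult power_Suc) (simp add: mult_ac)
  qed simp
  \<comment> \<open>For the binomial form, the numerator yields two factors \<open>fact k\<close>,
    which cancel the explicit one in the denominator and the one from its falling factorial.\<close>
  have "(\<Prod>j=1..k. (of_nat m + of_nat j - 1) * (of_nat n - of_nat j + 1)) =
      fact k * of_nat ((m + k - 1) choose k) * (fact k * of_nat (n choose k) :: complex)" for k
  proof -
    have "(\<Prod>j=1..k. of_nat n - of_nat j + 1) = (\<Prod>j=1..k. of_nat (Suc n) - of_nat j :: complex)"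
      by (intro prod.cong refl) simp
    then show ?thesis
      by (simp only: prod.distrib prod_of_nat_add_eq_fact_binomial[OF m]
          prod_of_nat_diff_eq_fact_binomial)
  qed
  moreover have "(\<Prod>j=1..k. of_nat m + of_nat n - of_nat j) =
      (fact k * of_nat ((m + n - 1) choose k) :: complex)" for k
    using prod_of_nat_diff_eq_fact_binomial[of "m + n - 1" k, where 'a = complex] m by simp
  ultimately have "(- 1) ^ k * (\<Prod>j=1..k. (of_nat m + of_nat j - 1) * (of_nat n - of_nat j + 1)) * z 0 ^ k
        / (fact k * (\<Prod>j=1..k. of_nat m + of_nat n - of_nat j)) =
      (- 1) ^ k * of_nat (n choose k) * of_nat ((m + k - 1) choose k) * z 0 ^ k
        / of_nat ((m + n - 1) choose k)" for k
    by simp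
  with prod_form show ?thesis
    by auto
qed

end
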